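(* Let $T\subset\mathbb{R}^2$ be a lattice-free triangle. Then $$\mathrm{p}(T)-2\,\mathrm{D}(T)\leq\frac{2}{\sqrt{3}}\left(1+\frac{\omega(T)}{\mathrm{D}(T)}\right).$$ In particular, $\mathrm{p}(T)-2\,\mathrm{D}(T)\leq 1+\frac{2}{\sqrt{3}}$. Moreover, equality holds in the first (displayed) inequality if and only if $T$ is an equilateral triangle with edge lengths $1+\frac{2}{\sqrt{3}}$.
   Context: A triangle is the convex hull of three affinely independent points of $\mathbb{R}^2$. $\mathrm{p}(T)$ denotes the perimeter, $\mathrm{D}(T)$ the diameter, and $\omega(T)$ the minimal width of $T$ (the minimal distance between two parallel supporting lines of $T$), all with respect to the Euclidean norm. $T$ is called lattice-free if its interior contains no point of the integer lattice $\mathbb{Z}^2$. *)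

theory Defs
  imports "HOL-Analysis.Analysis"
begin

definition integer_lattice :: "(real^2) set" where
  "integer_lattice = {z. \<forall>i. z $ i \<in> \<int>}"

definition lattice_free :: "(real^2) set \<Rightarrow> bool" where
  "lattice_free T \<longleftrightarrow> interior T \<inter> integer_lattice = {}"

text \<open>The perimeter of a convex polygon: the total length of its edges (the diameter of a
  segment is its length).  The definition is only meaningful for polygons, which have
  finitely many edges.\<close>

definition perimeter :: "(real^2) set \<Rightarrow> real" where
  "perimeter P = (\<Sum>E | E edge_of P. diameter E)"

lemma edges_of_triangle:
  fixes a b c :: "real^2"
  assumes "distinct [a, b, c]" "\<not> affine_dependent {a, b, c}"
  shows "{E. E edge_of convex hull {a, b, c}}
    = {closed_segment a b, closed_segment b c, closed_segment c a}" (is "?L = ?R")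
proof -
  have aff: "aff_dim (convex hull S) = int (card S) - 1" if "S \<subseteq> {a, b, c}" for S
    using aff_dim_affine_independent[OF affine_independent_subset[OF assms(2) that]]
    by (simp add: aff_dim_convex_hull)
  have seg: "closed_segment a b = convex hull {a, b}" "closed_segment b c = convex hull {b, c}"
    "closed_segment c a = convex hull {a, c}"
    by (simp_all add: segment_convex_hull insert_commute)
  have aff2: "aff_dim (convex hull S) = 1 \<longleftrightarrow> card S = 2" if "S \<subseteq> {a, b, c}" for S
    using aff[OF that] by simp
  have "?L = (\<lambda>S. convex hull S) ` {S. S \<subseteq> {a, b, c} \<and> card S = 2}"
    unfolding edge_of_def face_of_convex_hull_affine_independent[OF assms(2)]
    using aff2 by blast
  also have "{S. S \<subseteq> {a, b, c} \<and> card S = 2} = {{a, b}, {b, c}, {a, c}}"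
  proof -
    have "S \<in> {{a, b}, {b, c}, {a, c}}" if S: "S \<subseteq> {a, b, c}" "card S = 2" for S
    proof -
      obtain x y where "S = {x, y}" "x \<noteq> y"
        using S(2) by (auto simp: card_2_iff)
      then show ?thesis
        using S(1) by auto
    qed
    moreover have "card {a, b} = 2" "card {b, c} = 2" "card {a, c} = 2"
      using assms(1) by auto
    ultimately show ?thesis
      by blast
  qed
  finally show ?thesis
    by (simp add: seg)
qed

lemma diameter_closed_segment:
  fixes a b :: "real^2"
  shows "diameter (closed_segment a b) = dist a b"
proof (rule antisym)
  show "diameter (closed_segment a b) \<le> dist a b"
  proof (rule diameter_le)
    fix x y assume "x \<in> closed_segment a b" "y \<in> closed_segment a b"
    then have "\<exists>u\<in>{a, b}. \<exists>v\<in>{a, b}. norm (x - y) \<le> norm (u - v)"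
      by (intro simplex_extremal_le_exists) (simp_all add: segment_convex_hull)
    moreover have "norm (u - v) \<le> dist a b" if "u \<in> {a, b}" "v \<in> {a, b}" for u v
      using that by (auto simp: dist_norm norm_minus_commute)
    ultimately show "norm (x - y) \<le> dist a b"
      by (meson order_trans)
  qed simp
  show "dist a b \<le> diameter (closed_segment a b)"
    by (rule diameter_bounded_bound) (auto simp: bounded_closed_segment)
qed

lemma perimeter_triangle:
  fixes a b c :: "real^2"
  assumes "distinct [a, b, c]" "\<not> affine_dependent {a, b, c}"
  shows "perimeter (convex hull {a, b, c}) = dist a b + dist b c + dist c a"
proof -
  have "closed_segment a b \<noteq> closed_segment b c" "closed_segment a b \<noteq> closed_segment c a"
    "closed_segment b c \<noteq> closed_segment c a"
    using assms(1) by (auto simp: doubleton_eq_iff)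
  then show ?thesis
    by (simp add: perimeter_def edges_of_triangle[OF assms] diameter_closed_segment)
qed

definition supporting_line :: "(real^2) set \<Rightarrow> (real^2) set \<Rightarrow> bool" where
  "supporting_line T L \<longleftrightarrow>
     (\<exists>u s. u \<noteq> 0 \<and> L = {x. u \<bullet> x = s} \<and> L \<inter> T \<noteq> {} \<and> (\<forall>x\<in>T. u \<bullet> x \<le> s))"

text \<open>A line counts as parallel to itself for \<^const>\<open>affine_parallel\<close>, so the two
  supporting lines have to be required to be distinct; a planar compact convex set with nonempty
  interior has exactly two supporting lines in every direction.\<close>

definition minimal_width :: "(real^2) set \<Rightarrow> real" where
  "minimal_width T = Inf {setdist L M | L M.
     supporting_line T L \<and> supporting_line T M \<and> affine_parallel L M \<and> L \<noteq> M}"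

definition equilateral_of_edge_length :: "real \<Rightarrow> (real^2) set \<Rightarrow> bool" where
  "equilateral_of_edge_length l T \<longleftrightarrow> (\<forall>E. E edge_of T \<longrightarrow> diameter E = l)"

end

theory Submission
  imports Defs
begin

text \<open>Let \<open>z\<close> be the longest side of the triangle, \<open>x, y\<close> the other sides and \<open>h\<close> the height on \<open>z\<close>, so
  that the diameter is \<open>z\<close> and the minimal width is \<open>h\<close>.  Heron's formula gives
  \<open>x + y - z \<le> 2 / sqrt 3 * h\<close>, with equality only for equilateral triangles, so everything follows
  from Scott's inequality \<open>h \<le> 1 + h / z\<close>.

  For the latter, let \<open>H\<close> be the lattice width; \<open>h \<le> H\<close> because nonzero integer vectors have norm at
  least 1.  Use coordinates in which \<open>H\<close> is the extent in the \<open>y\<close>-direction, and let \<open>L\<close> be the length of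
  the longest horizontal chord.  The chords longer than 1 fill a strip of height \<open>H * (1 - 1 / L)\<close>
  that meets no lattice line, so \<open>H * (L - 1) \<le> L\<close>; this bounds twice the area \<open>L * H = h * z\<close> by
  \<open>H\<^sup>2 / (H - 1)\<close>, which suffices for \<open>H \<le> 2\<close>.  For \<open>H > 2\<close> one further lattice point next to the strip
  improves the chord bound.  Combined with the extents in two more lattice directions, which are at
  least \<open>H\<close>, this gives Hurkens' bound \<open>H \<le> 1 + 2 / sqrt 3\<close>, and Scott's inequality follows again
  because \<open>h \<le> sqrt 3 / 2 * z\<close>.\<close>

lemma integer_gap:
  fixes a b :: real
  assumes "\<And>n::int. a < n \<Longrightarrow> n < b \<Longrightarrow> False"
  obtains n :: int where "of_int n \<le> a" "b \<le> of_int n + 1"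
proof
  show "of_int \<lfloor>a\<rfloor> \<le> a" by simp
  show "b \<le> of_int \<lfloor>a\<rfloor> + 1"
  proof (rule ccontr)
    assume "\<not> b \<le> of_int \<lfloor>a\<rfloor> + 1"
    then show False
      using assms[of "\<lfloor>a\<rfloor> + 1"] by simp
  qed
qed

lemma largest_int_below:
  fixes r :: real
  obtains n :: int where "0 < r - n" "r - n \<le> 1"
proof
  show "0 < r - (\<lceil>r\<rceil> - 1)" "r - (\<lceil>r\<rceil> - 1) \<le> 1"
    by linarith+
qed

subsection \<open>Chords of a lattice-free triangle\<close>

text \<open>The triangle with vertices \<open>(x - L, m)\<close>, \<open>(x + p * s, m + p)\<close>, \<open>(x - q * s, m - q)\<close>, whose longest
  horizontal chord is at level \<open>m\<close> and has length \<open>L\<close>.  In \<open>no_point\<close>, \<open>\<alpha>\<close> is the barycentric coordinate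
  of the lattice point \<open>(X, Y)\<close> with respect to the first vertex.\<close>

locale slanted_triangle =
  fixes L m p q s x :: real
  assumes p: "0 \<le> p" and q: "0 \<le> q"
    and no_point: "\<And>(X::int) (Y::int) \<alpha>. L * \<alpha> = x + s * (Y - m) - X \<Longrightarrow> 0 < \<alpha>
      \<Longrightarrow> - q * (1 - \<alpha>) < Y - m \<Longrightarrow> Y - m < p * (1 - \<alpha>) \<Longrightarrow> False"
begin

text \<open>The chord at level \<open>m + t\<close> shrinks linearly to 0 at the extreme vertices,
  so those longer than 1 have levels between \<open>m - q * r\<close> and \<open>m + p * r\<close>.
  On an integer level such a chord would carry an interior lattice point, so no integer lies
  strictly between these bounds.\<close>

lemma long_chords_between_lattice_lines:
  assumes "1 < L"
  obtains Y :: int where "L * (m - Y) \<ge> q * (L - 1)" "L * (Y + 1 - m) \<ge> p * (L - 1)"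
proof -
  define r where "r = 1 - 1 / L"
  have r: "0 < r" "L * r = L - 1" using assms by (auto simp: r_def field_simps)
  have gap: False if Y: "m - q * r < Y" "Y < m + p * r" for Y :: int
  proof -
    \<comment> \<open>The chord at level \<open>Y\<close> is longer than 1.\<close>
    obtain X :: int where X: "0 < x + s * (Y - m) - X" "x + s * (Y - m) - X \<le> 1"
      by (rule largest_int_below)
    define \<alpha> where "\<alpha> = (x + s * (Y - m) - X) / L"
    have "0 < \<alpha>" "\<alpha> \<le> 1 / L" using X assms by (auto simp: \<alpha>_def divide_right_mono)
    then have "r \<le> 1 - \<alpha>" by (simp add: r_def)
    then have "p * r \<le> p * (1 - \<alpha>)" "q * r \<le> q * (1 - \<alpha>)"
      using p q by (auto intro: mult_left_mono)
    then show False
      using no_point[of \<alpha> Y X] Y \<open>0 < \<alpha>\<close> assms by (simp add: \<alpha>_def)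
  qed
  obtain Y :: int where Y: "Y \<le> m - q * r" "m + p * r \<le> of_int Y + 1"
    by (rule integer_gap[of "m - q * r" "m + p * r", OF gap])
  show thesis
  proof
    have "L * (q * r) \<le> L * (m - Y)" "L * (p * r) \<le> L * (Y + 1 - m)"
      using Y assms by auto
    then show "L * (m - Y) \<ge> q * (L - 1)" "L * (Y + 1 - m) \<ge> p * (L - 1)"
      using r(2) by (simp_all only: mult.left_commute[of L])
  qed
qed

lemma chord_bound:
  assumes "0 < L"
  shows "(p + q) * (L - 1) \<le> L"
proof (cases "1 < L")
  case True
  then obtain Y :: int where "L * (m - Y) \<ge> q * (L - 1)" "L * (Y + 1 - m) \<ge> p * (L - 1)"
    using long_chords_between_lattice_lines by blast
  then show ?thesis by (simp add: algebra_simps)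
next
  case False
  then show ?thesis
    using assms p q by (smt (verit) mult_nonneg_nonpos)
qed

text \<open>The bound on \<open>(p + q) * (L - 1)\<close> only uses lattice points at distance at
  most 1 from the slanted side. A point at distance at most \<open>1 - s\<close> on level
  \<open>Y\<close>, or at most \<open>s\<close> on level \<open>Y + 1\<close>, adds
  \<open>q * s\<close> or \<open>p * (1 - s)\<close> to it.\<close>

lemma sharper_chord_bound:
  assumes L: "1 < L" and "0 < p" "0 < q" and s: "0 \<le> s" "s < 1"
  shows "(p + q) * (L - 1) + q * s \<le> L \<or> (p + q) * (L - 1) + p * (1 - s) \<le> L"
proof -
  obtain Y :: int where Y: "L * (m - Y) \<ge> q * (L - 1)" "L * (Y + 1 - m) \<ge> p * (L - 1)"
    using long_chords_between_lattice_lines[OF L] by blast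
  \<comment> \<open>The longest chord lies strictly between two consecutive lattice lines.\<close>
  have pos: "0 < m - Y" "0 < Y + 1 - m"
    using Y assms by (smt (verit) mult_pos_pos zero_less_mult_pos)+
  define R where "R = x + s * (Y + 1 - m)"
  obtain X :: int where X: "0 < R - X" "R - X \<le> 1"
    by (rule largest_int_below)
  \<comment> \<open>The slanted side moves by \<open>s\<close> between the levels \<open>Y\<close> and \<open>Y + 1\<close>, so the nearest lattice point on
    one of these levels is at horizontal distance at most \<open>1 - s\<close> or \<open>s\<close> from it.\<close>
  show ?thesis
  proof (cases "0 < R - s - X")
    case True
    define \<alpha> where "\<alpha> = (R - s - X) / L"
    have \<alpha>: "0 < \<alpha>" "L * \<alpha> = R - s - X" "L * \<alpha> \<le> 1 - s"
      using True X L by (auto simp: \<alpha>_def)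
    have "\<alpha> < 1" 
    proof -
      have "L * \<alpha> < L * 1" using \<alpha>(3) L s by linarith
      then show ?thesis using L by simp
    qed
    then have "Y - m < p * (1 - \<alpha>)" using pos \<open>0 < p\<close> by (smt (verit) mult_pos_pos)
    moreover have "L * \<alpha> = x + s * (Y - m) - X"
      using \<alpha> by (simp add: R_def algebra_simps)
    \<comment> \<open>The point \<open>(X, Y)\<close> is below the longest chord and on the inner
      side of the slanted side, so it can only escape the interior across the lower side.\<close>
    ultimately have "Y - m \<le> - q * (1 - \<alpha>)"
      using no_point[of \<alpha> Y X] \<alpha>(1) by fastforce
    then have "L * (q * (1 - \<alpha>)) \<le> L * (m - Y)" using L by simp
    moreover have "L * (q * (1 - \<alpha>)) = q * (L - L * \<alpha>)" by (simp add: algebra_simps)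
    moreover have "q * (L - L * \<alpha>) \<ge> q * (L - (1 - s))"
      using \<alpha>(3) \<open>0 < q\<close> by simp
    ultimately have "q * (L - (1 - s)) \<le> L * (m - Y)" by linarith
    then have "(p + q) * (L - 1) + q * s \<le> L" using Y(2) by (simp add: algebra_simps)
    then show ?thesis ..
  next
    case False
    define \<alpha> where "\<alpha> = (R - X) / L"
    have \<alpha>: "0 < \<alpha>" "L * \<alpha> = R - X" "L * \<alpha> \<le> s"
      using False X L by (auto simp: \<alpha>_def)
    have "\<alpha> < 1" 
    proof -
      have "L * \<alpha> < L * 1" using \<alpha>(3) L s by linarith
      then show ?thesis using L by simp
    qed
    then have "- q * (1 - \<alpha>) < (Y + 1) - m" using pos \<open>0 < q\<close> by (smt (verit) mult_pos_pos minus_mult_left)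
    then have "p * (1 - \<alpha>) \<le> (Y + 1) - m"
      using no_point[of \<alpha> "Y + 1" X] \<alpha> by (fastforce simp: R_def)
    then have "L * (p * (1 - \<alpha>)) \<le> L * (Y + 1 - m)" using L by simp
    moreover have "L * (p * (1 - \<alpha>)) = p * (L - L * \<alpha>)" by (simp add: algebra_simps)
    moreover have "p * (L - L * \<alpha>) \<ge> p * (L - s)"
      using \<alpha>(3) \<open>0 < p\<close> by simp
    ultimately have "p * (L - s) \<le> L * (Y + 1 - m)" by linarith
    then have "(p + q) * (L - 1) + p * (1 - s) \<le> L" using Y(1) by (simp add: algebra_simps)
    then show ?thesis ..
  qed
qed

end

section \<open>Hurkens' bound on the height of a slanted triangle\<close>

lemma width_bound_algebra:
  fixes H L z :: real
  assumes H: "2 < H" and sq: "(H - L + z)\<^sup>2 \<le> H * z" and z: "H * (L - 1) + z \<le> L"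
  shows "3 * (H - 1)\<^sup>2 \<le> 4"
proof -
  define t where "t = H - 1"
  have t: "1 < t" "H = 1 + t" using H by (auto simp: t_def)
  have "z \<ge> 0" using sq H by (smt (verit) zero_le_power2 mult_less_0_iff)
  \<comment> \<open>Hypothesis \<open>z\<close> eliminates \<open>L\<close>. Squaring and inserting
    \<open>sq\<close> leaves an inequality in \<open>z\<close> and \<open>t\<close>; the
    arithmetic-geometric mean inequality for \<open>z\<close> and \<open>t - 1\<close> then makes
    \<open>z\<close> cancel.\<close>
  have "(1 + t) * (z + t - 1) \<le> t * (H - L + z)"
    using z unfolding t(2) by (simp add: algebra_simps)
  moreover have "0 \<le> (1 + t) * (z + t - 1)" using t \<open>z \<ge> 0\<close> by auto
  ultimately have "((1 + t) * (z + t - 1))\<^sup>2 \<le> (t * (H - L + z))\<^sup>2"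
    by (rule power_mono)
  also have "\<dots> = t\<^sup>2 * (H - L + z)\<^sup>2" by (simp add: power_mult_distrib)
  also have "\<dots> \<le> t\<^sup>2 * (H * z)" using sq by (intro mult_left_mono) auto
  finally have "(1 + t) * ((1 + t) * (z + t - 1)\<^sup>2) \<le> (1 + t) * (t\<^sup>2 * z)"
    unfolding t(2) by (simp add: power2_eq_square algebra_simps)
  then have 1: "(1 + t) * (z + t - 1)\<^sup>2 \<le> t\<^sup>2 * z" using t by simp
  have "4 * (z * (t - 1)) \<le> (z + t - 1)\<^sup>2"
    using zero_le_power2[of "z - (t - 1)"] by (simp add: power2_eq_square algebra_simps)
  then have "(1 + t) * (4 * (z * (t - 1))) \<le> (1 + t) * (z + t - 1)\<^sup>2"
    using t by simp
  with 1 have 2: "z * (4 * (t\<^sup>2 - 1)) \<le> z * t\<^sup>2"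
    by (simp add: power2_eq_square algebra_simps)
  have "z \<noteq> 0"
    using 1 t by (auto simp: mult_le_0_iff)
  with 2 \<open>z \<ge> 0\<close> have "4 * (t\<^sup>2 - 1) \<le> t\<^sup>2" by simp
  then show ?thesis by (simp add: t_def)
qed

text \<open>\<open>w1\<close> and \<open>w2\<close> express that two further lattice directions have
  extent at least the height. Their second alternatives are impossible once
  \<open>0 < s < 1\<close>, so \<open>H - L\<close> is at most both \<open>p * s\<close> and
  \<open>q * (1 - s)\<close>.\<close>

lemma (in slanted_triangle) height_bound:
  assumes L: "0 < L" and s: "0 \<le> s" "s < 1"
    and w1: "p + q \<le> L + p * s \<or> p + q \<le> (p + q) * s"
    and w2: "p + q \<le> L + q * (1 - s) \<or> p + q \<le> (p + q) * (1 - s)"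
    and H2: "2 < p + q"
  shows "3 * (p + q - 1)\<^sup>2 \<le> 4"
proof -
  define H where "H = p + q"
  have H: "2 < H" and Heq: "p + q = H" using H2 by (auto simp: H_def)
  have "H * (L - 1) \<le> L" using chord_bound L by (simp add: H_def)
  then have "L * (H - 1) \<le> H * 1" by (simp add: algebra_simps)
  also have "\<dots> < H * (H - 1)" using H by (intro mult_strict_left_mono) auto
  finally have LH: "L < H" using H by simp
  have "H * s < H" using H s by simp
  then have 1: "H - L \<le> p * s" using w1 Heq by auto
  have "s > 0" using 1 LH s p by (cases "s = 0") auto
  then have "H * (1 - s) < H" using H by simp
  then have 2: "H - L \<le> q * (1 - s)" using w2 Heq by auto
  have pq: "0 < p" "0 < q"
    using 1 2 LH s p q by (auto simp: less_le)
  \<comment> \<open>Multiplying the two bounds on \<open>H - L\<close> and using that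
    \<open>p * q\<close> and \<open>s * (1 - s)\<close> are largest at the midpoint gives
    \<open>L >= 3 / 4 * H\<close>, which exceeds 1.\<close>
  have "L > 1"
  proof -
    have "4 * (s * (1 - s)) \<le> 1"
      using zero_le_power2[of "1 - 2 * s"] by (simp add: power2_eq_square algebra_simps)
    moreover have "4 * (p * q) \<le> H\<^sup>2"
      unfolding H_def using zero_le_power2[of "p - q"] by (simp add: power2_eq_square algebra_simps)
    moreover have "(H - L)\<^sup>2 \<le> (p * s) * (q * (1 - s))"
      unfolding power2_eq_square using 1 2 LH by (intro mult_mono) auto
    moreover have "16 * ((p * s) * (q * (1 - s))) = (4 * (p * q)) * (4 * (s * (1 - s)))"
      by (simp add: algebra_simps)
    moreover have "\<dots> \<le> H\<^sup>2 * 1"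
      using calculation pq s by (intro mult_mono) auto
    ultimately have "16 * (H - L)\<^sup>2 \<le> H\<^sup>2" by linarith
    then have "(4 * (H - L))\<^sup>2 \<le> H\<^sup>2" by (simp only: power_mult_distrib) simp
    then have "4 * (H - L) \<le> H" by (rule power2_le_imp_le) (use H in simp)
    then show ?thesis using H by simp
  qed
  \<comment> \<open>Here \<open>z\<close> is the extra term of the sharper chord bound. Adding it to
    the two bounds on \<open>H - L\<close> turns them into \<open>H * a\<close> and
    \<open>b\<close>, whose product is \<open>H * z\<close>.\<close>
  have key: "3 * (H - 1)\<^sup>2 \<le> 4" if "0 \<le> z" "H - L + z \<le> H * a" "H - L + z \<le> b" "z = b * a"
    "H * (L - 1) + z \<le> L" for z a b
  proof (rule width_bound_algebra[OF H])
    have "(H - L + z) * (H - L + z) \<le> (H * a) * b"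
      using that LH by (intro mult_mono) auto
    then show "(H - L + z)\<^sup>2 \<le> H * z" using that by (simp add: power2_eq_square algebra_simps)
  qed (use that in auto)
  from sharper_chord_bound[OF \<open>L > 1\<close> pq s] show ?thesis
    unfolding Heq
  proof
    assume *: "H * (L - 1) + q * s \<le> L"
    have "H - L + q * s \<le> H * s" "H - L + q * s \<le> q"
      using 1 2 unfolding H_def by (simp_all add: algebra_simps)
    then show "3 * (H - 1)\<^sup>2 \<le> 4"
      using * s q by (intro key[of "q * s" s q]) auto
  next
    assume *: "H * (L - 1) + p * (1 - s) \<le> L"
    have "H - L + p * (1 - s) \<le> H * (1 - s)" "H - L + p * (1 - s) \<le> p"
      using 1 2 unfolding H_def by (simp_all add: algebra_simps)
    then show "3 * (H - 1)\<^sup>2 \<le> 4"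
      using * s p by (intro key[of "p * (1 - s)" "1 - s" p]) auto
  qed
qed

subsection \<open>Lattice width\<close>

definition cross2 :: "real^2 \<Rightarrow> real^2 \<Rightarrow> real" where
  "cross2 a b = a $ 1 * b $ 2 - a $ 2 * b $ 1"

text \<open>The extent of the triangle in direction \<open>u\<close>, scaled by the norm of
  \<open>u\<close>; its minimum over nonzero lattice vectors is the lattice width. Pairwise
  differences make it symmetric in the vertices.\<close>

definition spread :: "real^2 \<Rightarrow> real^2 \<Rightarrow> real^2 \<Rightarrow> real^2 \<Rightarrow> real" where
  "spread u a b c = max \<bar>u \<bullet> (a - b)\<bar> (max \<bar>u \<bullet> (b - c)\<bar> \<bar>u \<bullet> (c - a)\<bar>)"

lemma inner_real2: "a \<bullet> b = a $ 1 * b $ 1 + a $ 2 * b $ 2" for a b :: "real^2"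
  by (simp add: inner_vec_def sum_2)

lemma mem_integer_lattice: "z \<in> integer_lattice \<longleftrightarrow> z $ 1 \<in> \<int> \<and> z $ 2 \<in> \<int>"
  by (simp add: integer_lattice_def forall_2)

lemma cross2_determines:
  assumes "cross2 e f \<noteq> 0" "e \<bullet> v = e \<bullet> w" "f \<bullet> v = f \<bullet> w"
  shows "v = w"
proof -
  have "cross2 e f * (v $ 1 - w $ 1) = 0" "cross2 e f * (v $ 2 - w $ 2) = 0"
    using assms(2,3) unfolding cross2_def inner_real2 by algebra+
  then show ?thesis using assms(1) by (simp add: vec_eq_iff forall_2)
qed

lemma unimodular_surj:
  assumes e: "e \<in> integer_lattice" and f: "f \<in> integer_lattice" and ef: "(cross2 e f)\<^sup>2 = 1"
  obtains z where "z \<in> integer_lattice" "e \<bullet> z = of_int X" "f \<bullet> z = of_int Y"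
proof
  let ?d = "cross2 e f"
  \<comment> \<open>Cramer's rule; the determinant squares to 1, so it is its own inverse.\<close>
  let ?z = "vector [?d * (X * f $ 2 - Y * e $ 2), ?d * (Y * e $ 1 - X * f $ 1)] :: real^2"
  show "?z \<in> integer_lattice"
    using e f by (auto simp: mem_integer_lattice cross2_def)
  have "e \<bullet> ?z = ?d\<^sup>2 * X" "f \<bullet> ?z = ?d\<^sup>2 * Y"
    by (simp_all add: inner_real2 cross2_def power2_eq_square algebra_simps)
  then show "e \<bullet> ?z = of_int X" "f \<bullet> ?z = of_int Y" using ef by simp_all
qed

lemma lattice_free_barycentric:
  assumes "\<not> collinear {a, b, c}" "lattice_free (convex hull {a, b, c})" "z \<in> integer_lattice"
    and "0 < \<alpha>" "0 < \<beta>" "0 < \<gamma>" "\<alpha> + \<beta> + \<gamma> = 1"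
  shows "\<alpha> *\<^sub>R a + \<beta> *\<^sub>R b + \<gamma> *\<^sub>R c \<noteq> z"
proof
  assume "\<alpha> *\<^sub>R a + \<beta> *\<^sub>R b + \<gamma> *\<^sub>R c = z"
  then have "z \<in> interior (convex hull {a, b, c})"
    using assms by (subst interior_convex_hull_3_minimal) auto
  then show False using assms by (auto simp: lattice_free_def)
qed

lemma spread_from_apex:
  "spread u B V U = max \<bar>u \<bullet> (B - V)\<bar> (max \<bar>u \<bullet> (U - V)\<bar> \<bar>u \<bullet> (U - B)\<bar>)"
  by (simp add: spread_def inner_diff_right abs_minus_commute)

text \<open>In suitable lattice coordinates this is a slanted triangle with apex \<open>V\<close> at
  the middle level. Assumption \<open>pos\<close> puts \<open>V\<close> to the left of the side
  \<open>BU\<close>.\<close>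

lemma sorted_triangle_bounds:
  fixes B V U e f :: "real^2"
  assumes ncol: "\<not> collinear {B, V, U}"
    and free: "lattice_free (convex hull {B, V, U})"
    and e: "e \<in> integer_lattice" and f: "f \<in> integer_lattice" and ef: "(cross2 e f)\<^sup>2 = 1"
    and sorted: "f \<bullet> B \<le> f \<bullet> V" "f \<bullet> V \<le> f \<bullet> U"
    and minimal: "\<And>u. u \<in> integer_lattice \<Longrightarrow> u \<noteq> 0 \<Longrightarrow> f \<bullet> (U - B) \<le> spread u B V U"
    and pos: "0 < cross2 e f * cross2 (B - V) (U - V)"
  defines "A \<equiv> \<bar>cross2 (B - V) (U - V)\<bar>" and "H \<equiv> f \<bullet> (U - B)"
  shows "A * (H - 1) \<le> H\<^sup>2 \<and> (H \<le> 2 \<or> 3 * (H - 1)\<^sup>2 \<le> 4)"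
proof -
  define p q where "p = f \<bullet> (U - V)" and "q = f \<bullet> (V - B)"
  have p: "0 \<le> p" and q: "0 \<le> q" and H: "H = p + q"
    using sorted by (auto simp: p_def q_def H_def algebra_simps)
  define D where "D = cross2 e f * cross2 (B - V) (U - V)"
  have "\<bar>cross2 e f\<bar> = 1" using ef by (auto simp: power2_eq_1_iff)
  then have "\<bar>D\<bar> = A" by (simp add: D_def A_def abs_mult)
  with pos have D: "D = A" "0 < D" by (auto simp: D_def)
  have D_eq: "D = (e \<bullet> (B - V)) * p + q * (e \<bullet> (U - V))"
    by (simp add: D_def p_def q_def cross2_def inner_real2 algebra_simps)
  have "H \<noteq> 0" using D D_eq p q by (auto simp: H add_nonneg_eq_0_iff)
  then have H0: "0 < H" using p q H by simp
  \<comment> \<open>A shear normalizes the slope of the side \<open>BU\<close> to lie in \<open>[0, 1)\<close>.\<close>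
  define s0 where "s0 = e \<bullet> (U - B) / H"
  define e' where "e' = e - of_int \<lfloor>s0\<rfloor> *\<^sub>R f"
  define s where "s = s0 - of_int \<lfloor>s0\<rfloor>"
  have s: "0 \<le> s" "s < 1" by (simp_all add: s_def) linarith
  have cross': "cross2 e' f = cross2 e f" "cross2 (e' - f) f = cross2 e f"
    by (simp_all add: e'_def cross2_def algebra_simps)
  have e': "e' \<in> integer_lattice" and e'f: "e' - f \<in> integer_lattice"
    using e f by (auto simp: e'_def mem_integer_lattice)
  have ne: "e' \<noteq> 0" "e' - f \<noteq> 0"
    using cross' ef by (auto simp: cross2_def)
  \<comment> \<open>Twice the area divided by the height: the length of the chord from
    \<open>V\<close> to the side \<open>BU\<close>.\<close>
  define L where "L = D / H"
  have L: "0 < L" "D = L * H" using D H0 by (auto simp: L_def)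
  have sH: "e' \<bullet> (U - B) = s * H"
  proof -
    have "s0 * H = e \<bullet> (U - B)" using H0 by (simp add: s0_def)
    then show ?thesis
      by (simp add: e'_def s_def inner_diff_left left_diff_distrib H_def)
  qed
  have D_eq': "D = (e' \<bullet> (B - V)) * p + q * (e' \<bullet> (U - V))"
    unfolding D_eq by (simp add: e'_def p_def q_def algebra_simps)
  have diff: "e' \<bullet> (U - V) - e' \<bullet> (B - V) = s * H"
    unfolding sH[symmetric] by (simp add: algebra_simps)
  have "H * (e' \<bullet> (U - V)) = H * (L + p * s)" "H * (e' \<bullet> (B - V)) = H * (L - q * s)"
    using diff D_eq' L(2) unfolding H by algebra+
  then have UV: "e' \<bullet> (U - V) = L + p * s" and BV: "e' \<bullet> (B - V) = L - q * s"
    using H0 by auto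
  interpret slanted_triangle L "f \<bullet> V" p q s "e' \<bullet> V + L"
  proof
    fix X Y :: int and \<alpha> :: real
    assume \<alpha>: "L * \<alpha> = e' \<bullet> V + L + s * (Y - f \<bullet> V) - X" "0 < \<alpha>"
      and Y: "- q * (1 - \<alpha>) < Y - f \<bullet> V" "Y - f \<bullet> V < p * (1 - \<alpha>)"
    \<comment> \<open>The barycentric coordinates with respect to \<open>U\<close> and
      \<open>B\<close>, solved from the level of the point and the condition that all coordinates
      sum to 1.\<close>
    define \<gamma> \<beta> where "\<gamma> = ((Y - f \<bullet> V) + q * (1 - \<alpha>)) / H"
      and "\<beta> = (p * (1 - \<alpha>) - (Y - f \<bullet> V)) / H"
    have pos: "0 < \<gamma>" "0 < \<beta>" using Y H0 by (auto simp: \<gamma>_def \<beta>_def)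
    have \<gamma>H: "\<gamma> * H = (Y - f \<bullet> V) + q * (1 - \<alpha>)" and \<beta>H: "\<beta> * H = p * (1 - \<alpha>) - (Y - f \<bullet> V)"
      using H0 by (auto simp: \<gamma>_def \<beta>_def)
    have "H * (\<alpha> + \<beta> + \<gamma>) = H * 1" using \<gamma>H \<beta>H unfolding H by algebra
    then have sum1: "\<alpha> + \<beta> + \<gamma> = 1" using H0 by simp
    have "H * (\<gamma> * p - \<beta> * q) = H * (Y - f \<bullet> V)" using \<gamma>H \<beta>H unfolding H by algebra
    then have level: "\<gamma> * p - \<beta> * q = Y - f \<bullet> V" using H0 by simp
    obtain z where z: "z \<in> integer_lattice" "e' \<bullet> z = of_int X" "f \<bullet> z = of_int Y"
      using unimodular_surj[OF e' f] ef cross' by metis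
    let ?w = "\<beta> *\<^sub>R B + \<alpha> *\<^sub>R V + \<gamma> *\<^sub>R U"
    have bary: "g \<bullet> ?w = g \<bullet> V + \<beta> * (g \<bullet> (B - V)) + \<gamma> * (g \<bullet> (U - V))" for g
    proof -
      have \<alpha>1: "\<alpha> = 1 - \<beta> - \<gamma>" using sum1 by simp
      show ?thesis
        unfolding \<alpha>1 inner_add_right inner_diff_right inner_scaleR_right by algebra
    qed
    have "e' \<bullet> ?w = e' \<bullet> V + L * (\<beta> + \<gamma>) + s * (\<gamma> * p - \<beta> * q)"
      unfolding bary UV BV by (simp add: algebra_simps)
    also have "\<dots> = X" using \<alpha>(1) sum1 unfolding level by algebra
    finally have "e' \<bullet> ?w = e' \<bullet> z" using z by simp
    moreover have "f \<bullet> ?w = f \<bullet> V + (\<gamma> * p - \<beta> * q)"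
      unfolding bary by (simp add: p_def q_def algebra_simps)
    then have "f \<bullet> ?w = f \<bullet> z" using z level by simp
    moreover have "cross2 e' f \<noteq> 0" using cross' ef by auto
    ultimately have "?w = z" by (intro cross2_determines)
    then show False
      using lattice_free_barycentric[OF ncol free z(1) \<open>0 < \<beta>\<close> \<open>0 < \<alpha>\<close> \<open>0 < \<gamma>\<close>] sum1 by simp
  qed (use p q in auto)
  have 1: "A * (H - 1) \<le> H\<^sup>2"
  proof -
    have "H * (H * (L - 1)) \<le> H * L" using chord_bound[OF L(1)] H0 by (simp add: H)
    moreover have "A = L * H" using D(1) L(2) by simp
    ultimately show ?thesis by (simp add: algebra_simps power2_eq_square)
  qed
  \<comment> \<open>Minimality of \<open>f\<close> against \<open>e'\<close>. The term with
    \<open>L - q * s\<close> is dominated by the other two; \<open>w2\<close> treats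
    \<open>e' - f\<close> in the same way.\<close>
  have w1: "H \<le> L + p * s \<or> H \<le> H * s"
  proof -
    have "H \<le> max \<bar>L - q * s\<bar> (max \<bar>L + p * s\<bar> \<bar>H * s\<bar>)"
      using minimal[OF e' ne(1)] unfolding spread_from_apex UV BV sH H_def[symmetric]
      by (simp only: mult.commute[of s])
    moreover have "0 \<le> p * s" "0 \<le> q * s" "q * s \<le> H * s"
      using p q s by (auto simp: H intro: mult_right_mono)
    ultimately show ?thesis using L(1) unfolding le_max_iff_disj by linarith
  qed
  have w2: "H \<le> L + q * (1 - s) \<or> H \<le> H * (1 - s)"
  proof -
    have "(e' - f) \<bullet> (B - V) = L + q * (1 - s)" "(e' - f) \<bullet> (U - V) = L - p * (1 - s)"
      "(e' - f) \<bullet> (U - B) = - (H * (1 - s))"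
      using UV BV sH by (simp_all add: p_def q_def H_def algebra_simps)
    then have "H \<le> max \<bar>L + q * (1 - s)\<bar> (max \<bar>L - p * (1 - s)\<bar> \<bar>H * (1 - s)\<bar>)"
      using minimal[OF e'f ne(2)] unfolding spread_from_apex H_def[symmetric]
      by (simp only: abs_minus_cancel)
    moreover have "0 \<le> p * (1 - s)" "0 \<le> q * (1 - s)" "p * (1 - s) \<le> H * (1 - s)"
      using p q s by (auto simp: H intro: mult_right_mono)
    ultimately show ?thesis using L(1) unfolding le_max_iff_disj by linarith
  qed
  show ?thesis
    using 1 height_bound[OF L(1) s w1[unfolded H] w2[unfolded H]] unfolding H by linarith
qed

section \<open>Area, order of the vertices and spread\<close>

lemma cross2_scale: "cross2 (r *\<^sub>R u) v = r * cross2 u v"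
  by (simp add: cross2_def algebra_simps)

lemma lagrange_identity2: "(x \<bullet> y)\<^sup>2 + (cross2 x y)\<^sup>2 = (norm x)\<^sup>2 * (norm y)\<^sup>2"
  unfolding power2_norm_eq_inner inner_real2 cross2_def
  by (simp add: power2_eq_square algebra_simps)

lemma cross2_eq_0_imp_collinear:
  assumes "cross2 (a - b) (c - b) = 0"
  shows "collinear {a, b, c}"
proof -
  have sq: "((a - b) \<bullet> (c - b))\<^sup>2 = (norm (a - b) * norm (c - b))\<^sup>2"
    using lagrange_identity2[of "a - b" "c - b"] assms by (simp add: power_mult_distrib)
  have "\<bar>(a - b) \<bullet> (c - b)\<bar> = norm (a - b) * norm (c - b)"
    by (rule power2_eq_imp_eq) (use sq in simp_all)
  then have "collinear {0, a - b, c - b}" by (simp add: norm_cauchy_schwarz_equal)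
  then show ?thesis by (subst collinear_3) auto
qed

text \<open>A rotation and a reflection generate all six orders of the vertices, so invariance is
  checked only for these two.\<close>

lemma sort_vertices:
  fixes a b c :: "real^2"
  obtains B V U where "{B, V, U} = {a, b, c}" "f \<bullet> B \<le> f \<bullet> V" "f \<bullet> V \<le> f \<bullet> U"
    "\<bar>cross2 (B - V) (U - V)\<bar> = \<bar>cross2 (a - b) (c - b)\<bar>" "\<forall>u. spread u B V U = spread u a b c"
proof -
  note result = that
  define ok where "ok B V U \<longleftrightarrow> {B, V, U} = {a, b, c}
    \<and> \<bar>cross2 (B - V) (U - V)\<bar> = \<bar>cross2 (a - b) (c - b)\<bar>
    \<and> (\<forall>u. spread u B V U = spread u a b c)" for B V U
  have rot: "ok V U B" and refl: "ok U V B" if "ok B V U" for B V U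
  proof -
    have "cross2 (V - U) (B - U) = cross2 (B - V) (U - V)" "cross2 (U - V) (B - V) = - cross2 (B - V) (U - V)"
      by (simp_all add: cross2_def algebra_simps)
    moreover have "spread u V U B = spread u B V U" "spread u U V B = spread u B V U" for u
      by (simp_all add: spread_def inner_diff_right abs_minus_commute max.commute max.left_commute)
    ultimately show "ok V U B" "ok U V B" using that by (simp_all add: ok_def insert_commute)
  qed
  have "ok a b c" by (simp add: ok_def)
  note ok = this rot[OF this] rot[OF rot[OF this]]
  note ok = ok ok[THEN refl]
  have sorted: thesis if "ok B V U" "f \<bullet> B \<le> f \<bullet> V" "f \<bullet> V \<le> f \<bullet> U" for B V U
    using that(1) unfolding ok_def by (intro result[of B V U] that(2,3)) auto
  consider "f \<bullet> a \<le> f \<bullet> b" "f \<bullet> b \<le> f \<bullet> c" | "f \<bullet> b \<le> f \<bullet> c" "f \<bullet> c \<le> f \<bullet> a"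
    | "f \<bullet> c \<le> f \<bullet> a" "f \<bullet> a \<le> f \<bullet> b" | "f \<bullet> c \<le> f \<bullet> b" "f \<bullet> b \<le> f \<bullet> a"
    | "f \<bullet> a \<le> f \<bullet> c" "f \<bullet> c \<le> f \<bullet> b" | "f \<bullet> b \<le> f \<bullet> a" "f \<bullet> a \<le> f \<bullet> c"
    by linarith
  then show thesis
    using ok by cases (auto intro: sorted)
qed

lemma spread_sorted:
  assumes "f \<bullet> B \<le> f \<bullet> V" "f \<bullet> V \<le> f \<bullet> U"
  shows "spread f B V U = f \<bullet> (U - B)"
  using assms by (auto simp: spread_def inner_diff_right max_def)

text \<open>Twice the area times \<open>u\<close> turned by a right angle is a combination of the
  two edges at the middle vertex \<open>V\<close>; the absolute values of its coefficients add up to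
  the spread. This serves to compare height with lattice width, to make the lattice width attained,
  and to compute the minimal width.\<close>

lemma area_le_longest_side_times_spread:
  assumes M: "dist a b \<le> M" "dist b c \<le> M" "dist c a \<le> M"
  shows "\<bar>cross2 (a - b) (c - b)\<bar> * norm u \<le> M * spread u a b c"
proof -
  obtain B V U where BVU: "{B, V, U} = {a, b, c}" "u \<bullet> B \<le> u \<bullet> V" "u \<bullet> V \<le> u \<bullet> U"
    "\<bar>cross2 (B - V) (U - V)\<bar> = \<bar>cross2 (a - b) (c - b)\<bar>" "\<forall>v. spread v B V U = spread v a b c"
    by (rule sort_vertices[of a b c u]) (rule that; assumption)
  have dist_le: "dist x y \<le> M" if "x \<in> {B, V, U}" "y \<in> {B, V, U}" for x y
    using that M zero_le_dist[of a b] unfolding BVU(1) by (auto simp: dist_commute simp del: zero_le_dist)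
  let ?u' = "vector [- u $ 2, u $ 1] :: real^2"
  have "cross2 (B - V) (U - V) *\<^sub>R ?u' = (u \<bullet> (B - V)) *\<^sub>R (U - V) - (u \<bullet> (U - V)) *\<^sub>R (B - V)"
    by (simp add: vec_eq_iff forall_2 cross2_def inner_real2 algebra_simps)
  then have "\<bar>cross2 (B - V) (U - V)\<bar> * norm ?u' \<le> \<bar>u \<bullet> (B - V)\<bar> * norm (U - V) + \<bar>u \<bullet> (U - V)\<bar> * norm (B - V)"
    using norm_triangle_ineq4[of "(u \<bullet> (B - V)) *\<^sub>R (U - V)" "(u \<bullet> (U - V)) *\<^sub>R (B - V)"]
    by (metis norm_scaleR)
  also have "\<dots> \<le> \<bar>u \<bullet> (B - V)\<bar> * M + \<bar>u \<bullet> (U - V)\<bar> * M"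
    using dist_le by (intro add_mono mult_left_mono) (auto simp flip: dist_norm)
  also have "\<dots> = M * spread u B V U"
    unfolding spread_sorted[OF BVU(2,3)] using BVU(2,3) by (simp add: inner_diff_right algebra_simps)
  also have "norm ?u' = norm u"
    by (simp add: norm_eq_sqrt_inner inner_real2)
  finally show ?thesis using BVU by simp
qed

section \<open>A lattice direction of minimal spread and its completion to a basis\<close>

lemma norm_lattice_ge_1:
  assumes "u \<in> integer_lattice" "u \<noteq> 0"
  shows "1 \<le> norm u"
proof -
  obtain i where "u $ i \<noteq> 0" "u $ i \<in> \<int>" using assms by (auto simp: vec_eq_iff integer_lattice_def)
  then have "1 \<le> \<bar>u $ i\<bar>" by (rule Ints_nonzero_abs_ge1[rotated])
  also have "\<dots> \<le> norm u" by (rule component_le_norm_cart)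
  finally show ?thesis .
qed

lemma finite_lattice_ball: "finite {u \<in> integer_lattice. norm u \<le> r}"
proof (rule finite_subset)
  let ?I = "{z::real. z \<in> \<int> \<and> \<bar>z\<bar> \<le> r}"
  show "{u \<in> integer_lattice. norm u \<le> r} \<subseteq> (\<lambda>(x, y). vector [x, y]) ` (?I \<times> ?I)"
  proof
    fix u assume u: "u \<in> {u \<in> integer_lattice. norm u \<le> r}"
    then have "\<bar>u $ i\<bar> \<le> r" for i
      using component_le_norm_cart[of u i] by simp
    moreover have "u = vector [u $ 1, u $ 2]" by (simp add: vec_eq_iff forall_2)
    ultimately show "u \<in> (\<lambda>(x, y). vector [x, y]) ` (?I \<times> ?I)"
      using u by (intro image_eqI[of _ _ "(u $ 1, u $ 2)"]) (auto simp: mem_integer_lattice)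
  qed
  show "finite ((\<lambda>(x, y). vector [x, y] :: real^2) ` (?I \<times> ?I))"
    using finite_abs_int_segment[where ?'a=real] by (intro finite_imageI finite_SigmaI) auto
qed

text \<open>The area bound limits the norm of every \<open>u\<close> whose spread is at most that of
  a fixed vector \<open>g\<close>, so only finitely many lattice vectors compete.\<close>

lemma minimal_spread_exists:
  fixes a b c :: "real^2"
  assumes "\<not> collinear {a, b, c}"
  obtains f where "f \<in> integer_lattice" "f \<noteq> 0" "0 < spread f a b c"
    "\<forall>u\<in>integer_lattice. u \<noteq> 0 \<longrightarrow> spread f a b c \<le> spread u a b c"
proof -
  define M where "M = max (dist a b) (max (dist b c) (dist c a))"
  define A where "A = \<bar>cross2 (a - b) (c - b)\<bar>"
  have A: "0 < A" using assms cross2_eq_0_imp_collinear by (auto simp: A_def)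
  have "a \<noteq> b" using assms by auto
  then have M: "0 < M" by (simp add: M_def less_max_iff_disj)
  have area: "A * norm u \<le> M * spread u a b c" for u
    unfolding A_def by (rule area_le_longest_side_times_spread) (auto simp: M_def)
  define g :: "real^2" where "g = vector [1, 0]"
  have g: "g \<in> integer_lattice" "g \<noteq> 0" by (auto simp: g_def mem_integer_lattice vec_eq_iff forall_2)
  define S where "S = {u \<in> integer_lattice. u \<noteq> 0 \<and> spread u a b c \<le> spread g a b c}"
  have "norm u \<le> M * spread g a b c / A" if "u \<in> S" for u
  proof -
    have "A * norm u \<le> M * spread g a b c"
      using area[of u] that M by (auto simp: S_def intro: order_trans mult_left_mono)
    then show ?thesis using A by (simp add: pos_le_divide_eq mult.commute)
  qed
  then have "finite S"
    by (intro finite_subset[OF _ finite_lattice_ball[of "M * spread g a b c / A"]]) (auto simp: S_def)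
  have "g \<in> S" using g by (simp add: S_def)
  then have "S \<noteq> {}" by blast
  have f: "arg_min_on (\<lambda>u. spread u a b c) S \<in> S"
    by (rule arg_min_if_finite(1)[OF \<open>finite S\<close> \<open>S \<noteq> {}\<close>])
  have f': "spread (arg_min_on (\<lambda>u. spread u a b c) S) a b c \<le> spread u a b c" if "u \<in> S" for u
    by (rule arg_min_least[OF \<open>finite S\<close> \<open>S \<noteq> {}\<close> that])
  define f where "f = arg_min_on (\<lambda>u. spread u a b c) S"
  note f = f[folded f_def] and f' = f'[folded f_def]
  show thesis
  proof
    show "f \<in> integer_lattice" "f \<noteq> 0" using f by (auto simp: S_def)
    then have "0 < A * norm f" using A by simp
    then have "0 < M * spread f a b c" using area[of f] by linarith
    then show "0 < spread f a b c" using M by (simp add: zero_less_mult_iff)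
    have "spread f a b c \<le> spread u a b c" if "u \<in> integer_lattice" "u \<noteq> 0" for u
    proof (cases "u \<in> S")
      case True
      then show ?thesis by (rule f')
    next
      case False
      then have "spread g a b c < spread u a b c" using that by (simp add: S_def)
      moreover have "spread f a b c \<le> spread g a b c" using f by (simp add: S_def)
      ultimately show ?thesis by linarith
    qed
    then show "\<forall>u\<in>integer_lattice. u \<noteq> 0 \<longrightarrow> spread f a b c \<le> spread u a b c" by blast
  qed
qed

lemma spread_scale: "spread (r *\<^sub>R u) a b c = \<bar>r\<bar> * spread u a b c"
  by (simp add: spread_def abs_mult max_mult_distrib_left)

text \<open>A minimal \<open>f\<close> is primitive, since dividing by the gcd of its components
  would reduce the spread; Bezout coefficients then supply \<open>e\<close>.\<close>

lemma complete_to_lattice_basis: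
  assumes f: "f \<in> integer_lattice" "0 < spread f a b c"
    and min: "\<forall>u\<in>integer_lattice. u \<noteq> 0 \<longrightarrow> spread f a b c \<le> spread u a b c"
  obtains e where "e \<in> integer_lattice" "cross2 e f = 1"
proof -
  obtain j k :: int where jk: "f $ 1 = of_int j" "f $ 2 = of_int k"
    using f by (auto simp: mem_integer_lattice elim!: Ints_cases)
  have "j \<noteq> 0 \<or> k \<noteq> 0"
  proof (rule ccontr)
    assume "\<not> ?thesis"
    then have "f = 0" using jk by (simp add: vec_eq_iff forall_2)
    then show False using f by (simp add: spread_def)
  qed
  define g where "g = gcd j k"
  have g: "0 < g" using \<open>j \<noteq> 0 \<or> k \<noteq> 0\<close> by (simp add: g_def)
  obtain j' k' where jk': "j = g * j'" "k = g * k'" using gcd_dvd1 gcd_dvd2 unfolding g_def dvd_def by metis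
  let ?f = "vector [of_int j', of_int k'] :: real^2"
  have f_eq: "f = of_int g *\<^sub>R ?f" using jk jk' by (simp add: vec_eq_iff forall_2)
  have "spread f a b c \<le> spread ?f a b c"
    using f_eq f(2) by (intro min[rule_format]) (auto simp: mem_integer_lattice spread_def)
  moreover have "spread f a b c = of_int g * spread ?f a b c"
    using g by (subst f_eq) (simp add: spread_scale)
  ultimately have "real_of_int g * spread ?f a b c \<le> 1 * spread ?f a b c" "0 < spread ?f a b c"
    using f(2) g by (auto simp: zero_less_mult_iff)
  then have "g = 1" using g by simp
  then obtain u v where uv: "u * j + v * k = 1" using bezout_int[of j k] by (auto simp: g_def)
  show thesis
  proof
    let ?e = "vector [of_int v, - of_int u] :: real^2"
    show "?e \<in> integer_lattice" by (simp add: mem_integer_lattice)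
    have "cross2 ?e f = of_int (u * j + v * k)" by (simp add: cross2_def jk)
    then show "cross2 ?e f = 1" using uv by simp
  qed
qed

lemma lattice_width_bounds:
  fixes a b c :: "real^2"
  assumes ncol: "\<not> collinear {a, b, c}" and free: "lattice_free (convex hull {a, b, c})"
  defines "A \<equiv> \<bar>cross2 (a - b) (c - b)\<bar>"
  obtains f where "f \<in> integer_lattice" "f \<noteq> 0"
    "A * (spread f a b c - 1) \<le> (spread f a b c)\<^sup>2"
    "spread f a b c \<le> 2 \<or> 3 * (spread f a b c - 1)\<^sup>2 \<le> 4"
proof -
  obtain f where f: "f \<in> integer_lattice" "f \<noteq> 0" "0 < spread f a b c"
    "\<forall>u\<in>integer_lattice. u \<noteq> 0 \<longrightarrow> spread f a b c \<le> spread u a b c"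
    by (rule minimal_spread_exists[OF ncol]) (rule that; assumption)
  obtain e0 where e0: "e0 \<in> integer_lattice" "cross2 e0 f = 1"
    by (rule complete_to_lattice_basis[OF f(1,3,4)]) (rule that; assumption)
  obtain B V U where BVU: "{B, V, U} = {a, b, c}" "f \<bullet> B \<le> f \<bullet> V" "f \<bullet> V \<le> f \<bullet> U"
    "\<bar>cross2 (B - V) (U - V)\<bar> = \<bar>cross2 (a - b) (c - b)\<bar>" "\<forall>v. spread v B V U = spread v a b c"
    by (rule sort_vertices[of a b c f]) (rule that; assumption)
  have H: "f \<bullet> (U - B) = spread f a b c" using spread_sorted[OF BVU(2,3)] BVU(5) by simp
  have "A \<noteq> 0" using ncol cross2_eq_0_imp_collinear by (auto simp: A_def)
  \<comment> \<open>The sign gives the basis the orientation of the triangle, as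
    \<open>sorted_triangle_bounds\<close> demands.\<close>
  define e where "e = sgn (cross2 (B - V) (U - V)) *\<^sub>R e0"
  have cross: "cross2 e f = sgn (cross2 (B - V) (U - V))"
    using e0(2) by (simp add: e_def cross2_scale)
  have "A * (f \<bullet> (U - B) - 1) \<le> (f \<bullet> (U - B))\<^sup>2
    \<and> (f \<bullet> (U - B) \<le> 2 \<or> 3 * (f \<bullet> (U - B) - 1)\<^sup>2 \<le> 4)"
    unfolding A_def BVU(4)[symmetric]
  proof (rule sorted_triangle_bounds)
    show "\<not> collinear {B, V, U}" "lattice_free (convex hull {B, V, U})"
      using ncol free BVU(1) by simp_all
    show "e \<in> integer_lattice" using e0 by (auto simp: e_def mem_integer_lattice sgn_real_def)
    show "(cross2 e f)\<^sup>2 = 1" "0 < cross2 e f * cross2 (B - V) (U - V)"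
      unfolding cross using BVU(4) \<open>A \<noteq> 0\<close>[unfolded A_def] by (auto simp: sgn_real_def)
    show "f \<bullet> (U - B) \<le> spread u B V U" if "u \<in> integer_lattice" "u \<noteq> 0" for u
      unfolding H BVU(5)[rule_format] using f(4) that by blast
  qed (use f BVU in auto)
  then have bounds: "A * (spread f a b c - 1) \<le> (spread f a b c)\<^sup>2
    \<and> (spread f a b c \<le> 2 \<or> 3 * (spread f a b c - 1)\<^sup>2 \<le> 4)"
    by (simp only: H)
  show thesis
    by (rule that[OF f(1,2) bounds[THEN conjunct1] bounds[THEN conjunct2]])
qed

section \<open>Scott's inequality\<close>

lemma scott_algebra:
  fixes h H M :: real
  assumes h: "0 < h" "h \<le> H" and M: "0 < M" "4 * h\<^sup>2 \<le> 3 * M\<^sup>2"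
    and area: "h * M * (H - 1) \<le> H\<^sup>2" and H: "H \<le> 2 \<or> 3 * (H - 1)\<^sup>2 \<le> 4"
  shows "M * (h - 1) \<le> h"
proof (cases "h \<le> 1")
  case True
  then have "M * (h - 1) \<le> 0" using M by (simp add: mult_nonneg_nonpos)
  then show ?thesis using h by simp
next
  case False
  \<comment> \<open>The function \<open>(1 + t)\<^sup>2 / t = t + 1 / t + 2\<close> is decreasing on \<open>(0, 1]\<close> and invariant under
    \<open>t \<mapsto> 1 / t\<close>, so the bound on the area transfers from \<open>t\<close> to \<open>s\<close> if \<open>s * t \<le> 1\<close>.\<close>
  define s t where "s = h - 1" and "t = H - 1"
  have s: "0 < s" "s \<le> t" "h = 1 + s" "H = 1 + t" using h False by (auto simp: s_def t_def)
  have area': "h * M * t \<le> (1 + t)\<^sup>2" using area s by simp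
  show ?thesis
  proof (cases "s * t \<le> 1")
    case True
    have "t * (h * (M * s)) \<le> s * (1 + t)\<^sup>2"
      using mult_left_mono[OF area', of s] s by (simp add: mult.commute mult.left_commute)
    also have "\<dots> \<le> t * (1 + s)\<^sup>2"
    proof -
      have "0 \<le> (t - s) * (1 - s * t)" using s True by simp
      then show ?thesis by (simp add: power2_eq_square algebra_simps)
    qed
    finally have "h * (M * s) \<le> h * h" using s by (simp add: power2_eq_square)
    then show ?thesis using s by simp
  next
    \<comment> \<open>This case is contradictory: \<open>t > 1\<close> makes Hurkens' bound
      available, and it clashes with the area bound and the flatness \<open>M(2)\<close>.\<close>
    case False
    have "1 < t"
    proof (rule ccontr)
      assume "\<not> 1 < t"
      then have "s * t \<le> 1 * 1" using s by (intro mult_mono) auto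
      then show False using False by simp
    qed
    then have t: "3 * t\<^sup>2 \<le> 4" using H s by simp
    have "1 + t < h * t" using False s by (simp add: algebra_simps)
    then have "(1 + t) ^ 4 < (h * t) ^ 4" using s by (intro power_strict_mono) auto
    also have "\<dots> = h ^ 4 * t\<^sup>2 * t\<^sup>2" by (simp add: power_mult_distrib flip: power_add)
    finally have 1: "(1 + t) ^ 4 < h ^ 4 * t\<^sup>2 * t\<^sup>2" .
    have "(h * M * t)\<^sup>2 \<le> ((1 + t)\<^sup>2)\<^sup>2"
      using area' s M by (intro power_mono) auto
    then have 2: "h\<^sup>2 * t\<^sup>2 * M\<^sup>2 \<le> (1 + t) ^ 4"
      by (simp add: power_mult_distrib mult.commute mult.left_commute flip: power_mult)
    have "h\<^sup>2 * t\<^sup>2 * (4 * h\<^sup>2) \<le> h\<^sup>2 * t\<^sup>2 * (3 * M\<^sup>2)"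
      by (rule mult_left_mono[OF M(2)]) simp
    moreover have "h\<^sup>2 * t\<^sup>2 * (4 * h\<^sup>2) = 4 * (h ^ 4 * t\<^sup>2)"
      by (simp flip: power_add)
    ultimately have "4 * (h ^ 4 * t\<^sup>2) < 3 * (h ^ 4 * t\<^sup>2 * t\<^sup>2)" using 1 2 by linarith
    also have "\<dots> = (h ^ 4 * t\<^sup>2) * (3 * t\<^sup>2)" by simp
    also have "\<dots> \<le> (h ^ 4 * t\<^sup>2) * 4" using t by (intro mult_left_mono) auto
    finally show ?thesis by linarith
  qed
qed

text \<open>With \<open>M\<close> the longest side, \<open>h\<close> is the height on it, and
  \<open>flat\<close> says that it is at most the height of an equilateral triangle of side
  \<open>M\<close>.\<close>

lemma scott_inequality_triangle:
  assumes ncol: "\<not> collinear {a, b, c}" and free: "lattice_free (convex hull {a, b, c})"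
    and M: "dist a b \<le> M" "dist b c \<le> M" "dist c a \<le> M"
  defines "h \<equiv> \<bar>cross2 (a - b) (c - b)\<bar> / M"
  assumes flat: "4 * h\<^sup>2 \<le> 3 * M\<^sup>2"
  shows "h \<le> 1 + h / M"
proof -
  define A where "A = \<bar>cross2 (a - b) (c - b)\<bar>"
  have A: "0 < A" using ncol cross2_eq_0_imp_collinear by (auto simp: A_def)
  have "a \<noteq> b" using ncol by auto
  then have "0 < dist a b" by simp
  then have M0: "0 < M" using M(1) by linarith
  have h: "0 < h" "h * M = A" using A M0 by (simp_all add: h_def A_def)
  obtain f where f: "f \<in> integer_lattice" "f \<noteq> 0"
    "A * (spread f a b c - 1) \<le> (spread f a b c)\<^sup>2"
    "spread f a b c \<le> 2 \<or> 3 * (spread f a b c - 1)\<^sup>2 \<le> 4"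
    unfolding A_def by (rule lattice_width_bounds[OF ncol free])
  have "M * h = A * 1" using h by (simp add: mult.commute)
  also have "\<dots> \<le> A * norm f" using norm_lattice_ge_1[OF f(1,2)] A by simp
  also have "\<dots> \<le> M * spread f a b c"
    unfolding A_def by (rule area_le_longest_side_times_spread[OF M])
  finally have "h \<le> spread f a b c" using M0 by simp
  then have "M * (h - 1) \<le> h"
    using f(3,4) h M0 flat by (intro scott_algebra[of h "spread f a b c" M]) auto
  then show ?thesis using M0 by (simp add: field_simps)
qed

subsection \<open>Metric properties of triangles\<close>

text \<open>Lagrange's identity combined with the law of cosines. As \<open>cross2\<close> is twice
  the signed area, the left side is 16 times the squared area.\<close>

lemma heron:
  "4 * (cross2 (a - b) (c - b))\<^sup>2
    = ((dist c a + dist a b)\<^sup>2 - (dist b c)\<^sup>2) * ((dist b c)\<^sup>2 - (dist c a - dist a b)\<^sup>2)"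
proof -
  define P Q R where "P = dist a b" and "Q = dist b c" and "R = dist c a"
  define k where "k = (a - b) \<bullet> (c - b)"
  have "norm (a - b) = P" "norm (c - b) = Q"
    by (simp_all add: P_def Q_def dist_norm norm_minus_commute)
  then have "k\<^sup>2 + (cross2 (a - b) (c - b))\<^sup>2 = P\<^sup>2 * Q\<^sup>2"
    using lagrange_identity2[of "a - b" "c - b"] by (simp add: k_def)
  moreover have "R\<^sup>2 = P\<^sup>2 + Q\<^sup>2 - 2 * k"
    unfolding P_def Q_def R_def k_def dist_norm power2_norm_eq_inner
    by (simp add: inner_diff_left inner_diff_right inner_commute)
  ultimately show ?thesis
    unfolding P_def[symmetric] Q_def[symmetric] R_def[symmetric] by algebra
qed

lemma semiperimeter_excess:
  fixes x y z A :: real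
  assumes heron: "4 * A\<^sup>2 = ((x + y)\<^sup>2 - z\<^sup>2) * (z\<^sup>2 - (x - y)\<^sup>2)"
    and A: "0 < A" and z: "0 < z" "x \<le> z" "y \<le> z" "z \<le> x + y"
  shows "x + y - z \<le> 2 / sqrt 3 * (A / z)"
    and "x + y - z = 2 / sqrt 3 * (A / z) \<Longrightarrow> x = z \<and> y = z"
proof -
  define \<sigma> d where "\<sigma> = x + y" and "d = x - y"
  have "\<sigma> \<noteq> z" using heron A by (auto simp: \<sigma>_def)
  then have \<sigma>: "z < \<sigma>" "\<sigma> \<le> 2 * z" using z by (auto simp: \<sigma>_def)
  have d: "d\<^sup>2 \<le> (2 * z - \<sigma>)\<^sup>2"
    by (rule power2_le_iff_abs_le[THEN iffD2]) (use z in \<open>auto simp: \<sigma>_def d_def\<close>)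
  \<comment> \<open>Both summands on the right are nonnegative, because \<open>x\<close> and
    \<open>y\<close> are at most \<open>z\<close>. Equality in the lemma forces
    \<open>\<sigma> = 2 * z\<close>, hence three equal sides.\<close>
  have "4 * A\<^sup>2 - 3 * z\<^sup>2 * (\<sigma> - z)\<^sup>2
      = (\<sigma> - z) * ((\<sigma> - z) * \<sigma> * (2 * z - \<sigma>) + (\<sigma> + z) * ((2 * z - \<sigma>)\<^sup>2 - d\<^sup>2))"
    unfolding heron by (simp add: \<sigma>_def d_def power2_eq_square algebra_simps)
  also have "\<dots> \<ge> (\<sigma> - z) * ((\<sigma> - z) * \<sigma> * (2 * z - \<sigma>))"
    using \<sigma> z d by (intro mult_left_mono) auto
  finally have key: "(\<sigma> - z)\<^sup>2 * \<sigma> * (2 * z - \<sigma>) \<le> (2 * A)\<^sup>2 - (sqrt 3 * z * (\<sigma> - z))\<^sup>2"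
    by (simp add: power_mult_distrib power2_eq_square algebra_simps)
  moreover have "0 \<le> (\<sigma> - z)\<^sup>2 * \<sigma> * (2 * z - \<sigma>)" using \<sigma> z by simp
  ultimately have "(sqrt 3 * z * (\<sigma> - z))\<^sup>2 \<le> (2 * A)\<^sup>2" by linarith
  then have "sqrt 3 * z * (\<sigma> - z) \<le> 2 * A"
    by (rule power2_le_imp_le) (use A in simp)
  then show "x + y - z \<le> 2 / sqrt 3 * (A / z)"
    using z by (simp add: field_simps \<sigma>_def)
  assume "x + y - z = 2 / sqrt 3 * (A / z)"
  then have "sqrt 3 * z * (\<sigma> - z) = 2 * A"
    using z by (simp add: field_simps \<sigma>_def)
  then have "(\<sigma> - z)\<^sup>2 * \<sigma> * (2 * z - \<sigma>) \<le> 0" using key by simp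
  then have "2 * z \<le> \<sigma>" using \<sigma> z by (simp add: mult_le_0_iff)
  then show "x = z \<and> y = z" using z by (auto simp: \<sigma>_def)
qed

lemma height_on_longest_side:
  fixes x y z A :: real
  assumes heron: "4 * A\<^sup>2 = ((x + y)\<^sup>2 - z\<^sup>2) * (z\<^sup>2 - (x - y)\<^sup>2)"
    and z: "0 < z" "0 \<le> x" "0 \<le> y" "x \<le> z" "y \<le> z" "z \<le> x + y"
  shows "4 * (A / z)\<^sup>2 \<le> 3 * z\<^sup>2"
proof -
  have "(x + y)\<^sup>2 \<le> (2 * z)\<^sup>2" by (rule power_mono) (use z in auto)
  moreover have "z\<^sup>2 \<le> (x + y)\<^sup>2" by (rule power_mono) (use z in auto)
  ultimately have "4 * A\<^sup>2 \<le> (3 * z\<^sup>2) * z\<^sup>2"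
    unfolding heron using z by (intro mult_mono) (auto simp: power_mult_distrib abs_le_square_iff[symmetric])
  then show ?thesis using z by (simp add: field_simps power2_eq_square)
qed

section \<open>Supporting lines, minimal width and diameter\<close>

lemma supporting_lineI:
  assumes "u \<noteq> 0" "x \<in> T" "u \<bullet> x = s" "(\<forall>y\<in>T. u \<bullet> y \<le> s) \<or> (\<forall>y\<in>T. s \<le> u \<bullet> y)"
  shows "supporting_line T {y. u \<bullet> y = s}"
  using assms(4)
proof
  assume "\<forall>y\<in>T. u \<bullet> y \<le> s"
  then show ?thesis unfolding supporting_line_def using assms by blast
next
  assume "\<forall>y\<in>T. s \<le> u \<bullet> y"
  moreover have "{y. u \<bullet> y = s} = {y. (- u) \<bullet> y = - s}" by auto
  ultimately show ?thesis unfolding supporting_line_def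
    using assms by (intro exI[of _ "- u"] exI[of _ "- s"]) auto
qed

text \<open>The two lines come with unrelated normals. As a translate of \<open>L\<close>, the line
  \<open>M\<close> is a level set of the same \<open>u\<close>, and convexity keeps \<open>T\<close>
  on the side of \<open>M\<close> that faces \<open>L\<close>.\<close>

lemma supporting_lines_enclose:
  assumes T: "convex T" and L: "supporting_line T L" and M: "supporting_line T M"
    and par: "affine_parallel L M" and neq: "L \<noteq> M"
  obtains u s r where "u \<noteq> 0" "L = {x. u \<bullet> x = s}" "M = {x. u \<bullet> x = r}"
    "\<forall>x\<in>T. r \<le> u \<bullet> x \<and> u \<bullet> x \<le> s"
proof -
  obtain u s where u: "u \<noteq> 0" "L = {x. u \<bullet> x = s}" "L \<inter> T \<noteq> {}" "\<forall>x\<in>T. u \<bullet> x \<le> s"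
    using L unfolding supporting_line_def by metis
  obtain v t where v: "v \<noteq> 0" "M = {x. v \<bullet> x = t}" "M \<inter> T \<noteq> {}" "\<forall>x\<in>T. v \<bullet> x \<le> t"
    using M unfolding supporting_line_def by metis
  obtain w where w: "M = (\<lambda>x. w + x) ` L" using par unfolding affine_parallel_def by metis
  define r where "r = s + u \<bullet> w"
  have Mr: "M = {x. u \<bullet> x = r}"
  proof
    show "M \<subseteq> {x. u \<bullet> x = r}" unfolding w u(2) r_def by (auto simp: inner_add_right)
    show "{x. u \<bullet> x = r} \<subseteq> M"
    proof
      fix x assume "x \<in> {x. u \<bullet> x = r}"
      then have "x - w \<in> L" by (simp add: u(2) r_def inner_diff_right)
      then have "w + (x - w) \<in> M" unfolding w by (rule imageI)
      then show "x \<in> M" by simp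
    qed
  qed
  have "r \<noteq> s" using neq Mr u(2) by auto
  obtain y where y: "y \<in> T" "u \<bullet> y = r" using v(3) Mr by auto
  then have "r < s" using u(4) \<open>r \<noteq> s\<close> by force
  obtain z where z: "z \<in> T" "u \<bullet> z = s" using u(2,3) by auto
  \<comment> \<open>If \<open>T\<close> had points on both sides of \<open>M\<close>, a segment joining them would cross the supporting line \<open>M\<close>.\<close>
  have "r \<le> u \<bullet> x" if "x \<in> T" for x
  proof (rule ccontr)
    assume "\<not> r \<le> u \<bullet> x"
    then have lt: "u \<bullet> x < r" by simp
    define l where "l = (r - u \<bullet> x) / (s - u \<bullet> x)"
    have l: "0 < l" "l < 1" "l * (s - u \<bullet> x) = r - u \<bullet> x"
      using lt \<open>r < s\<close> by (auto simp: l_def)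
    define p where "p = (1 - l) *\<^sub>R x + l *\<^sub>R z"
    have "u \<bullet> p = u \<bullet> x + l * (s - u \<bullet> x)"
      by (simp add: p_def z(2) inner_add_right algebra_simps)
    then have "p \<in> M" using l(3) by (simp add: Mr)
    then have "(1 - l) * (v \<bullet> x) + l * (v \<bullet> z) = t"
      by (simp add: v(2) p_def inner_add_right)
    moreover have "(1 - l) * (v \<bullet> x) \<le> (1 - l) * t" "l * (v \<bullet> z) \<le> l * t"
      using v(4) that z(1) l by (auto intro!: mult_left_mono)
    moreover have "(1 - l) * t + l * t = t" by (simp add: algebra_simps)
    ultimately have "(1 - l) * (v \<bullet> x) = (1 - l) * t" by linarith
    then have "x \<in> M" using l by (simp add: v(2))
    then show False using lt by (simp add: Mr)
  qed
  then show thesis using that[OF u(1,2) Mr] u(4) by blast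
qed

text \<open>The area bound shows that no pair of supporting lines is closer than the height on the
  longest side; the line through \<open>b\<close> and \<open>c\<close> and its parallel through
  \<open>a\<close> attain it.\<close>

lemma minimal_width_triangle:
  fixes a b c :: "real^2"
  assumes ncol: "\<not> collinear {a, b, c}" and long: "dist a b \<le> dist b c" "dist c a \<le> dist b c"
  shows "minimal_width (convex hull {a, b, c}) = \<bar>cross2 (a - b) (c - b)\<bar> / dist b c"
proof -
  let ?T = "convex hull {a, b, c}"
  define A where "A = \<bar>cross2 (a - b) (c - b)\<bar>"
  let ?W = "{setdist L M | L M.
     supporting_line ?T L \<and> supporting_line ?T M \<and> affine_parallel L M \<and> L \<noteq> M}"
  have bc: "0 < dist b c" using ncol by (auto simp: insert_commute)
  have mem: "a \<in> ?T" "b \<in> ?T" "c \<in> ?T" by (simp_all add: hull_inc)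
  have lower: "A / dist b c \<le> w" if w: "w \<in> ?W" for w
  proof -
    obtain L M where LM: "w = setdist L M" "supporting_line ?T L" "supporting_line ?T M"
      "affine_parallel L M" "L \<noteq> M"
      using w by blast
    obtain u s r where u: "u \<noteq> 0" "L = {x. u \<bullet> x = s}" "M = {x. u \<bullet> x = r}"
      "\<forall>x\<in>?T. r \<le> u \<bullet> x \<and> u \<bullet> x \<le> s"
      by (rule supporting_lines_enclose[OF convex_convex_hull LM(2-5)]) (rule that; assumption)
    have "A * norm u \<le> dist b c * spread u a b c"
      unfolding A_def by (rule area_le_longest_side_times_spread) (use long in auto)
    moreover have "spread u a b c \<le> s - r"
      using u(4)[rule_format, OF mem(1)] u(4)[rule_format, OF mem(2)] u(4)[rule_format, OF mem(3)]
      by (auto simp: spread_def inner_diff_right)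
    then have "dist b c * spread u a b c \<le> dist b c * (s - r)"
      by (rule mult_left_mono) simp
    ultimately have "A * norm u \<le> dist b c * (s - r)" by linarith
    then have area: "A / dist b c \<le> (s - r) / norm u"
      using bc u(1) by (simp add: field_simps)
    show ?thesis
      unfolding LM(1)
    proof (rule le_setdistI)
      show "L \<noteq> {}" "M \<noteq> {}" using LM(2,3) by (auto simp: supporting_line_def)
      fix x y assume "x \<in> L" "y \<in> M"
      then have "s - r = u \<bullet> (x - y)" by (simp add: u inner_diff_right)
      also have "\<dots> \<le> norm u * dist x y" unfolding dist_norm by (rule norm_cauchy_schwarz)
      finally have "(s - r) / norm u \<le> dist x y" using u(1) by (simp add: field_simps)
      with area show "A / dist b c \<le> dist x y" by linarith
    qed
  qed
  have "\<exists>w\<in>?W. w \<le> A / dist b c"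
  proof -
    define u :: "real^2" where "u = vector [- (c - b) $ 2, (c - b) $ 1]"
    define k where "k = u \<bullet> (a - b)"
    have k: "\<bar>k\<bar> = A" by (simp add: k_def u_def A_def cross2_def inner_real2 algebra_simps)
    have "k \<noteq> 0" using k ncol cross2_eq_0_imp_collinear by (auto simp: A_def)
    have nu: "norm u = dist b c"
      by (simp add: u_def norm_eq_sqrt_inner inner_real2 dist_norm power2_eq_square algebra_simps)
    have "u \<noteq> 0" using nu bc by auto
    have ub: "u \<bullet> c = u \<bullet> b" "u \<bullet> a = u \<bullet> b + k"
      by (simp_all add: u_def k_def inner_real2 algebra_simps)
    have le: "u \<bullet> x \<le> max (u \<bullet> b) (u \<bullet> a)" if "x \<in> ?T" for x
    proof -
      have "?T \<subseteq> {x. u \<bullet> x \<le> max (u \<bullet> b) (u \<bullet> a)}"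
        by (rule hull_minimal) (use ub in \<open>auto simp: convex_halfspace_le\<close>)
      then show ?thesis using that by auto
    qed
    have ge: "min (u \<bullet> b) (u \<bullet> a) \<le> u \<bullet> x" if "x \<in> ?T" for x
    proof -
      have "?T \<subseteq> {x. u \<bullet> x \<ge> min (u \<bullet> b) (u \<bullet> a)}"
        by (rule hull_minimal) (use ub in \<open>auto simp: convex_halfspace_ge\<close>)
      then show ?thesis using that by auto
    qed
    let ?L = "{x. u \<bullet> x = u \<bullet> b}" and ?M = "{x. u \<bullet> x = u \<bullet> a}"
    have between: "(\<forall>x\<in>?T. u \<bullet> b \<le> u \<bullet> x \<and> u \<bullet> x \<le> u \<bullet> a) \<or> (\<forall>x\<in>?T. u \<bullet> a \<le> u \<bullet> x \<and> u \<bullet> x \<le> u \<bullet> b)"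
      using le ge by (cases "u \<bullet> b \<le> u \<bullet> a") auto
    have "supporting_line ?T ?L"
      by (rule supporting_lineI[OF \<open>u \<noteq> 0\<close> mem(2)]) (use between in auto)
    moreover have "supporting_line ?T ?M"
      by (rule supporting_lineI[OF \<open>u \<noteq> 0\<close> mem(1)]) (use between in auto)
    moreover have "affine_parallel ?L ?M"
    proof -
      have "?M \<subseteq> (\<lambda>x. (a - b) + x) ` ?L"
      proof
        fix x assume "x \<in> ?M"
        then show "x \<in> (\<lambda>x. (a - b) + x) ` ?L"
          by (intro image_eqI[of _ _ "x - (a - b)"]) (auto simp: inner_diff_right)
      qed
      moreover have "(\<lambda>x. (a - b) + x) ` ?L \<subseteq> ?M" by (auto simp: inner_add_right inner_diff_right)
      ultimately show ?thesis unfolding affine_parallel_def by blast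
    qed
    moreover have "?L \<noteq> ?M" using ub(2) \<open>k \<noteq> 0\<close> by auto
    moreover have "setdist ?L ?M \<le> A / dist b c"
    proof -
      \<comment> \<open>The foot of the perpendicular from \<open>a\<close> to the line through
        \<open>b\<close> and \<open>c\<close>.\<close>
      define a' where "a' = a - (k / (u \<bullet> u)) *\<^sub>R u"
      have "a' \<in> ?L" using \<open>u \<noteq> 0\<close> ub(2) by (simp add: a'_def inner_diff_right)
      then have "setdist ?L ?M \<le> dist a' a" by (intro setdist_le_dist) auto
      also have "\<dots> = \<bar>k\<bar> / norm u"
        using \<open>u \<noteq> 0\<close> by (simp add: a'_def dist_norm dot_square_norm power2_eq_square)
      finally show ?thesis by (simp add: k nu)
    qed
    ultimately show ?thesis by blast
  qed
  then obtain w where w: "w \<in> ?W" "w \<le> A / dist b c" by blast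
  have "Inf ?W \<le> w"
    by (rule cInf_lower[OF w(1)]) (use lower in \<open>auto simp: bdd_below_def\<close>)
  moreover have "A / dist b c \<le> Inf ?W"
    using w(1) lower by (intro cInf_greatest) blast+
  ultimately show ?thesis using w(2) unfolding minimal_width_def A_def by linarith
qed

lemma diameter_triangle:
  fixes a b c :: "real^2"
  assumes long: "dist a b \<le> dist b c" "dist c a \<le> dist b c"
  shows "diameter (convex hull {a, b, c}) = dist b c"
proof (rule antisym)
  show "diameter (convex hull {a, b, c}) \<le> dist b c"
  proof (rule diameter_le)
    fix x y assume "x \<in> convex hull {a, b, c}" "y \<in> convex hull {a, b, c}"
    then obtain u v where "u \<in> {a, b, c}" "v \<in> {a, b, c}" "norm (x - y) \<le> norm (u - v)"
      using simplex_extremal_le_exists[of "{a, b, c}" x y] by blast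
    moreover have "norm (u - v) \<le> dist b c" if "u \<in> {a, b, c}" "v \<in> {a, b, c}" for u v
      using that long by (auto simp: dist_norm norm_minus_commute)
    ultimately show "norm (x - y) \<le> dist b c" by (meson order_trans)
  qed simp
  show "dist b c \<le> diameter (convex hull {a, b, c})"
    by (rule diameter_bounded_bound) (auto simp: hull_inc bounded_convex_hull)
qed

lemma simplex2_longest_side:
  fixes T :: "(real^2) set"
  assumes "2 simplex T"
  obtains a b c where "T = convex hull {a, b, c}" "distinct [a, b, c]"
    "\<not> affine_dependent {a, b, c}" "dist a b \<le> dist b c" "dist c a \<le> dist b c"
proof -
  obtain C where C: "\<not> affine_dependent C" "card C = 3" "T = convex hull C"
    using assms by (auto simp: simplex_def)
  then obtain x y z where xyz: "C = {x, y, z}" "x \<noteq> y" "x \<noteq> z" "y \<noteq> z"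
    by (auto simp: card_3_iff)
  consider "dist x y \<le> dist y z" "dist z x \<le> dist y z" | "dist y z \<le> dist z x" "dist x y \<le> dist z x"
    | "dist z x \<le> dist x y" "dist y z \<le> dist x y"
    by linarith
  then show thesis
  proof cases
    case 1
    then show ?thesis using that[of x y z] C xyz by auto
  next
    case 2
    then show ?thesis using that[of y z x] C xyz by (auto simp: insert_commute)
  next
    case 3
    then show ?thesis using that[of z x y] C xyz by (auto simp: insert_commute)
  qed
qed

section \<open>The perimeter inequality and its equality case\<close>

theorem theorem1p2:
  fixes T :: "(real^2) set"
  assumes triangle: "2 simplex T"
    and free: "lattice_free T"
  shows "perimeter T - 2 * diameter T \<le> 2 / sqrt 3 * (1 + minimal_width T / diameter T)
    \<and> perimeter T - 2 * diameter T \<le> 1 + 2 / sqrt 3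
    \<and> (perimeter T - 2 * diameter T = 2 / sqrt 3 * (1 + minimal_width T / diameter T)
         \<longleftrightarrow> equilateral_of_edge_length (1 + 2 / sqrt 3) T)"
proof -
  obtain a b c where T: "T = convex hull {a, b, c}" and abc: "distinct [a, b, c]"
    "\<not> affine_dependent {a, b, c}" and long: "dist a b \<le> dist b c" "dist c a \<le> dist b c"
    by (rule simplex2_longest_side[OF triangle]) (rule that; assumption)
  have ncol: "\<not> collinear {a, b, c}" using abc by (simp add: collinear_3_eq_affine_dependent)
  define x y z where "x = dist c a" and "y = dist a b" and "z = dist b c"
  define A where "A = \<bar>cross2 (a - b) (c - b)\<bar>"
  define h where "h = A / z"
  have A: "0 < A" using ncol cross2_eq_0_imp_collinear by (auto simp: A_def)
  have z: "0 < z" "0 \<le> x" "0 \<le> y" "x \<le> z" "y \<le> z" "z \<le> x + y"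
    using abc long dist_triangle[of b c a] by (auto simp: x_def y_def z_def dist_commute add.commute)
  have H: "4 * A\<^sup>2 = ((x + y)\<^sup>2 - z\<^sup>2) * (z\<^sup>2 - (x - y)\<^sup>2)"
    using heron[of a b c] by (simp add: A_def x_def y_def z_def)
  have width: "minimal_width T = h"
    using minimal_width_triangle[OF ncol long] by (simp add: T h_def A_def z_def)
  have diam: "diameter T = z" using diameter_triangle[OF long] by (simp add: T z_def)
  have excess: "perimeter T - 2 * z = x + y - z"
    using perimeter_triangle[OF abc] by (simp add: T x_def y_def z_def)
  have flat: "4 * h\<^sup>2 \<le> 3 * z\<^sup>2"
    unfolding h_def by (rule height_on_longest_side[OF H z])
  have scott: "h \<le> 1 + h / z"
    unfolding h_def A_def
    by (rule scott_inequality_triangle[OF ncol])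
      (use free long flat in \<open>simp_all add: T z_def h_def A_def\<close>)
  have ex1: "x + y - z \<le> 2 / sqrt 3 * h"
    unfolding h_def by (rule semiperimeter_excess(1)[OF H A z(1,4,5,6)])
  have ex2: "x = z \<and> y = z" if "x + y - z = 2 / sqrt 3 * h"
    using that unfolding h_def by (rule semiperimeter_excess(2)[OF H A z(1,4,5,6)])
  have scott': "2 / sqrt 3 * h \<le> 2 / sqrt 3 * (1 + h / z)"
    using scott by (rule mult_left_mono) simp
  have equi: "h = sqrt 3 / 2 * z" if "x = z" "y = z"
  proof -
    have sq: "(2 * A)\<^sup>2 = (sqrt 3 * z\<^sup>2)\<^sup>2"
      using H unfolding that by (simp add: power_mult_distrib power2_eq_square)
    have "2 * A = sqrt 3 * z\<^sup>2"
      by (rule power2_eq_imp_eq[OF sq]) (use A in auto)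
    then have "A = (sqrt 3 / 2 * z) * z" unfolding power2_eq_square by linarith
    then show ?thesis using z by (simp add: h_def)
  qed
  \<comment> \<open>Flatness bounds \<open>h / z\<close> by a constant, which turns the first
    inequality into the second.\<close>
  have "(2 * h)\<^sup>2 \<le> (sqrt 3 * z)\<^sup>2" using flat by (simp add: power_mult_distrib)
  then have "2 * h \<le> sqrt 3 * z" by (rule power2_le_imp_le) (use z in simp)
  then have "h / z \<le> sqrt 3 / 2" using z by (simp add: field_simps)
  then have "2 / sqrt 3 * (1 + h / z) \<le> 2 / sqrt 3 * (1 + sqrt 3 / 2)"
    by (intro mult_left_mono add_left_mono) auto
  also have const: "2 / sqrt 3 * (1 + sqrt 3 / 2) = 1 + 2 / sqrt 3"
    by (simp add: field_simps)
  finally have bound: "2 / sqrt 3 * (1 + h / z) \<le> 1 + 2 / sqrt 3" .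
  have equilateral: "equilateral_of_edge_length l T \<longleftrightarrow> x = l \<and> y = l \<and> z = l" for l
  proof -
    have "equilateral_of_edge_length l T \<longleftrightarrow> (\<forall>E \<in> {E. E edge_of T}. diameter E = l)"
      by (simp add: equilateral_of_edge_length_def)
    then show ?thesis
      unfolding T edges_of_triangle[OF abc] by (auto simp: diameter_closed_segment x_def y_def z_def)
  qed
  have "x + y - z = 2 / sqrt 3 * (1 + h / z) \<longleftrightarrow> x = 1 + 2 / sqrt 3 \<and> y = 1 + 2 / sqrt 3 \<and> z = 1 + 2 / sqrt 3"
  proof
    assume eq: "x + y - z = 2 / sqrt 3 * (1 + h / z)"
    \<comment> \<open>Equality overall forces equality in \<open>ex1\<close>, hence an equilateral
      triangle. Then \<open>h / z\<close> is known and \<open>x + y - z\<close> is the common side,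
      so the assumed equation determines the length.\<close>
    have "x + y - z = 2 / sqrt 3 * h" using eq ex1 scott' by linarith
    then have xyz: "x = z" "y = z" using ex2 by blast+
    have "h / z = sqrt 3 / 2" using equi[OF xyz] z(1) by simp
    then have "x + y - z = 1 + 2 / sqrt 3" unfolding eq by (simp only: const)
    then show "x = 1 + 2 / sqrt 3 \<and> y = 1 + 2 / sqrt 3 \<and> z = 1 + 2 / sqrt 3"
      unfolding xyz by linarith
  next
    assume *: "x = 1 + 2 / sqrt 3 \<and> y = 1 + 2 / sqrt 3 \<and> z = 1 + 2 / sqrt 3"
    then have "x = z" "y = z" by (elim conjE, simp only:)+
    then have "h / z = sqrt 3 / 2" using equi z(1) by simp
    then have "2 / sqrt 3 * (1 + h / z) = 1 + 2 / sqrt 3" by (simp only: const)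
    then show "x + y - z = 2 / sqrt 3 * (1 + h / z)" using * by linarith
  qed
  moreover have "x + y - z \<le> 2 / sqrt 3 * (1 + h / z)" using ex1 scott' by linarith
  moreover have "x + y - z \<le> 1 + 2 / sqrt 3" using ex1 scott' bound by linarith
  ultimately show ?thesis unfolding diam width excess equilateral by (intro conjI)
qed

end
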